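(* Suppose bounds $X^{\min}_{mn}\le X^{\max}_{mn}$, $1\le m,n\le N+1$, are given such that $X_{mn}\in[X^{\min}_{mn},X^{\max}_{mn}]$ for every feasible point $(\boldsymbol{z},\mathbf{X})$ of the problem $$\text{(P1)}\qquad \min_{\boldsymbol{z},\,\mathbf{X}}\ \left\|\mathbf{X}\tilde{\mathbf{p}}(\boldsymbol{z})-\hat{\boldsymbol{\theta}}-\boldsymbol{\delta}\right\|\quad\text{s.t.}\quad \tilde{\mathbf{B}}(\boldsymbol{z})\mathbf{X}=\mathbf{I},$$ over $\boldsymbol{z}=(\{z^j\}_{j\in\mathcal{N}_i},z^g,z^d)\in\{0,1\}^{|\mathcal{N}_i|+2}$ and $\mathbf{X}\in\mathbb{R}^{(N+1)\times(N+1)}$. Then (P1) is equivalent to the mixed-integer program $$\text{(P2)}\qquad \min_{\boldsymbol{z},\,\mathbf{X},\,\{\mathbf{Y}^j\},\,\{\mathbf{W}^p\}}\ \left\|\mathbf{X}\bar{\mathbf{p}}+\mathbf{W}^g\boldsymbol{\delta}^g-\mathbf{W}^d\boldsymbol{\delta}^d-\hat{\boldsymbol{\theta}}-\boldsymbol{\delta}\right\|$$ over $\boldsymbol{z}\in\{0,1\}^{|\mathcal{N}_i|+2}$ and $\mathbf{X},\mathbf{Y}^j\,(j\in\mathcal{N}_i),\mathbf{W}^g,\mathbf{W}^d\in\mathbb{R}^{(N+1)\times(N+1)}$, subject to the linear constraints $$\bar{\mathbf{B}}\mathbf{X}+\sum_{j\in\mathcal{N}_i}\mathbf{D}^j\mathbf{Y}^j=\mathbf{I}$$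 and, for all $1\le m,n\le N+1$, all $j\in\mathcal{N}_i$ and all $p\in\{g,d\}$, $$Y^j_{mn}\ge z^jX^{\min}_{mn},\qquad Y^j_{mn}\ge X_{mn}+z^jX^{\max}_{mn}-X^{\max}_{mn},$$ $$Y^j_{mn}\le z^jX^{\max}_{mn},\qquad Y^j_{mn}\le X_{mn}+z^jX^{\min}_{mn}-X^{\min}_{mn},$$ $$W^p_{mn}\ge z^pX^{\min}_{mn},\qquad W^p_{mn}\ge X_{mn}+z^pX^{\max}_{mn}-X^{\max}_{mn},$$ $$W^p_{mn}\le z^pX^{\max}_{mn},\qquad W^p_{mn}\le X_{mn}+z^pX^{\min}_{mn}-X^{\min}_{mn}.$$ Here equivalent means that $(\boldsymbol{z},\mathbf{X})$ is feasible for (P1) if and only if there exist $\{\mathbf{Y}^j\},\mathbf{W}^g,\mathbf{W}^d$ such that $(\boldsymbol{z},\mathbf{X},\{\mathbf{Y}^j\},\{\mathbf{W}^p\})$ is feasible for (P2), and the corresponding objective values coincide.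
   Context: A transmission network has buses $\{0,1,\dots,N\}$ and a set $\mathcal{L}$ of lines; line $(k,m)$ has reactance $x_{km}>0$ and $b_{km}=b_{mk}=1/x_{km}$. $\mathcal{N}_k$ is the set of buses adjacent to bus $k$. Bus $0$ is the reference bus with angle $0$. $\mathbf{B}\in\mathbb{R}^{N\times N}$ is the matrix, indexed by buses $1,\dots,N$, with $B_{kk}=\sum_{m\in\mathcal{N}_k}b_{km}$, $B_{km}=-b_{km}$ if $(k,m)\in\mathcal{L}$, and $B_{km}=0$ otherwise. $\mathbf{p}\in\mathbb{R}^N$ is the vector of power injections and $\boldsymbol{\theta}=\mathbf{B}^{-1}\mathbf{p}\in\mathbb{R}^N$ the pre-split angle vector. A bus $i$, with generation $g_i\in\mathbb{R}$ and load $d_i\in\mathbb{R}$ (injection $p_i=g_i-d_i$), may split into $i$ and a new bus $i'$, the $(N+1)$-st coordinate of the augmented system. Binary variables: $z^j=1$ if the line from $i$ to $j\in\mathcal{N}_i$ is reconnected to $i'$ and $z^j=0$ if it stays at $i$; $z^g,z^d$ indicate likewise whether the generation and the load are reconnected to $i'$. Below, $\mathbf{e}_k\in\mathbb{R}^{N+1}$ are standard basis vectors, with $\mathbf{e}_{i'}=\mathbf{e}_{N+1}$ and $\mathbf{e}_0=\mathbf{0}$. Define $$\bar{\mathbf{B}}=\begin{bmatrix}\mathbf{B}&\mathbf{0}\\ \mathbf{0}^{\mathsf T}&0\end{bmatrix},\qquad \mathbf{D}^j=b_{ij}\left[(\mathbf{e}_{i'}-\mathbf{e}_j)(\mathbf{e}_{i'}-\mathbf{e}_j)^{\mathsf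 T}-(\mathbf{e}_i-\mathbf{e}_j)(\mathbf{e}_i-\mathbf{e}_j)^{\mathsf T}\right],\qquad \tilde{\mathbf{B}}(\boldsymbol{z})=\bar{\mathbf{B}}+\sum_{j\in\mathcal{N}_i}z^j\mathbf{D}^j,$$ $$\bar{\mathbf{p}}=\begin{bmatrix}\mathbf{p}\\0\end{bmatrix},\qquad \boldsymbol{\delta}^g=g_i(\mathbf{e}_{i'}-\mathbf{e}_i),\qquad \boldsymbol{\delta}^d=d_i(\mathbf{e}_{i'}-\mathbf{e}_i),\qquad \tilde{\mathbf{p}}(\boldsymbol{z})=\bar{\mathbf{p}}+z^g\boldsymbol{\delta}^g-z^d\boldsymbol{\delta}^d.$$ Further, $\hat{\boldsymbol{\theta}}=[\boldsymbol{\theta};\theta_i]\in\mathbb{R}^{N+1}$ (with $\theta_0=0$), $\boldsymbol{\delta}\in\mathbb{R}^{N+1}$ is a given vector (the observed phase angle differences), $\|\cdot\|$ is a fixed vector norm on $\mathbb{R}^{N+1}$ (e.g. $L_1$, $L_2$ or $L_\infty$), and $\mathbf{I}$ is the $(N+1)\times(N+1)$ identity matrix. *)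

theory Defs
  imports "HOL-Analysis.Analysis"
begin

text \<open>
  The buses \<open>1, \<dots>, N\<close> are the elements of a finite type \<open>'n\<close> (so \<open>N = CARD('n)\<close>);
  \<open>None\<close> is the reference bus \<open>0\<close> and \<open>Some k\<close> is bus \<open>k\<close>.
  In the augmented system of dimension \<open>N + 1\<close>, \<open>Inl k\<close> is the coordinate of bus \<open>k\<close> and
  \<open>Inr ()\<close> is the last coordinate, which belongs to the new bus \<open>i'\<close>.
\<close>

type_synonym 'n bus = "'n option"
type_synonym 'n aug = "'n + unit"

text \<open>
  An undirected line between \<open>k\<close> and \<open>m\<close> is represented by both pairs \<open>(k, m)\<close> and \<open>(m, k)\<close>.
\<close>

definition transmission_network :: "('n bus \<times> 'n bus) set \<Rightarrow> ('n bus \<Rightarrow> 'n bus \<Rightarrow> real) \<Rightarrow> bool" where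
  "transmission_network L x \<longleftrightarrow> sym L \<and> irrefl L \<and> (\<forall>(k, m) \<in> L. x k m > 0 \<and> x k m = x m k)"

definition neighbors :: "('n bus \<times> 'n bus) set \<Rightarrow> 'n bus \<Rightarrow> 'n bus set" where
  "neighbors L k = {m. (k, m) \<in> L}"

definition suscept :: "('n bus \<Rightarrow> 'n bus \<Rightarrow> real) \<Rightarrow> 'n bus \<Rightarrow> 'n bus \<Rightarrow> real" where
  "suscept x k m = 1 / x k m"

definition B_mat ::
  "('n::finite bus \<times> 'n bus) set \<Rightarrow> ('n bus \<Rightarrow> 'n bus \<Rightarrow> real) \<Rightarrow> real^'n^'n" where
  "B_mat L x = (\<chi> k m.
     if k = m then (\<Sum>l \<in> neighbors L (Some k). suscept x (Some k) l)
     else if (Some k, Some m) \<in> L then - suscept x (Some k) (Some m)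
     else 0)"

definition theta ::
  "('n::finite bus \<times> 'n bus) set \<Rightarrow> ('n bus \<Rightarrow> 'n bus \<Rightarrow> real) \<Rightarrow> real^'n \<Rightarrow> real^'n" where
  "theta L x p = matrix_inv (B_mat L x) *v p"

definition theta_hat ::
  "('n::finite bus \<times> 'n bus) set \<Rightarrow> ('n bus \<Rightarrow> 'n bus \<Rightarrow> real) \<Rightarrow> real^'n \<Rightarrow> 'n bus \<Rightarrow> real^('n aug)" where
  "theta_hat L x p i = (\<chi> r. case r of
       Inl k \<Rightarrow> theta L x p $ k
     | Inr _ \<Rightarrow> (case i of None \<Rightarrow> 0 | Some k \<Rightarrow> theta L x p $ k))"

definition e_bus :: "'n::finite bus \<Rightarrow> real^('n aug)" where
  "e_bus k = (case k of None \<Rightarrow> 0 | Some l \<Rightarrow> axis (Inl l) 1)"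

definition e_new :: "real^('n::finite aug)" where
  "e_new = axis (Inr ()) 1"

definition outer :: "real^'a \<Rightarrow> real^'b \<Rightarrow> real^'b^'a" where
  "outer u v = (\<chi> r c. u $ r * v $ c)"

definition B_bar ::
  "('n::finite bus \<times> 'n bus) set \<Rightarrow> ('n bus \<Rightarrow> 'n bus \<Rightarrow> real) \<Rightarrow> real^('n aug)^('n aug)" where
  "B_bar L x = (\<chi> r c. case (r, c) of (Inl k, Inl m) \<Rightarrow> B_mat L x $ k $ m | _ \<Rightarrow> 0)"

definition D_mat ::
  "('n::finite bus \<Rightarrow> 'n bus \<Rightarrow> real) \<Rightarrow> 'n bus \<Rightarrow> 'n bus \<Rightarrow> real^('n aug)^('n aug)" where
  "D_mat x i j = suscept x i j *\<^sub>R
     (outer (e_new - e_bus j) (e_new - e_bus j) - outer (e_bus i - e_bus j) (e_bus i - e_bus j))"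

definition p_bar :: "real^'n::finite \<Rightarrow> real^('n aug)" where
  "p_bar p = (\<chi> r. case r of Inl k \<Rightarrow> p $ k | Inr _ \<Rightarrow> 0)"

text \<open>
  The vector of injected or consumed power moved from \<open>i\<close> to \<open>i'\<close>: it is \<open>\<delta>\<^sup>g\<close> for \<open>a = g\<^sub>i\<close> and
  \<open>\<delta>\<^sup>d\<close> for \<open>a = d\<^sub>i\<close>.
\<close>

definition shift :: "'n::finite bus \<Rightarrow> real \<Rightarrow> real^('n aug)" where
  "shift i a = a *\<^sub>R (e_new - e_bus i)"

text \<open>Only the values of \<open>z_line\<close> at the neighbors of the split bus are ever used.\<close>

record 'n switching =
  z_line :: "'n bus \<Rightarrow> real"
  z_gen :: real
  z_load :: real

definition binary :: "'n bus set \<Rightarrow> 'n switching \<Rightarrow> bool" where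
  "binary J z \<longleftrightarrow> (\<forall>j \<in> J. z_line z j \<in> {0, 1}) \<and> z_gen z \<in> {0, 1} \<and> z_load z \<in> {0, 1}"

definition B_tilde ::
  "('n::finite bus \<times> 'n bus) set \<Rightarrow> ('n bus \<Rightarrow> 'n bus \<Rightarrow> real) \<Rightarrow> 'n bus \<Rightarrow> 'n switching
    \<Rightarrow> real^('n aug)^('n aug)" where
  "B_tilde L x i z = B_bar L x + (\<Sum>j \<in> neighbors L i. z_line z j *\<^sub>R D_mat x i j)"

definition p_tilde ::
  "real^'n::finite \<Rightarrow> 'n bus \<Rightarrow> real \<Rightarrow> real \<Rightarrow> 'n switching \<Rightarrow> real^('n aug)" where
  "p_tilde p i g d z = p_bar p + z_gen z *\<^sub>R shift i g - z_load z *\<^sub>R shift i d"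

definition vector_norm :: "(real^'a \<Rightarrow> real) \<Rightarrow> bool" where
  "vector_norm nrm \<longleftrightarrow>
     (\<forall>v. nrm v \<ge> 0) \<and> (\<forall>v. nrm v = 0 \<longleftrightarrow> v = 0) \<and>
     (\<forall>a v. nrm (a *\<^sub>R v) = \<bar>a\<bar> * nrm v) \<and> (\<forall>u v. nrm (u + v) \<le> nrm u + nrm v)"

definition P1_feasible ::
  "('n::finite bus \<times> 'n bus) set \<Rightarrow> ('n bus \<Rightarrow> 'n bus \<Rightarrow> real) \<Rightarrow> 'n bus
    \<Rightarrow> 'n switching \<Rightarrow> real^('n aug)^('n aug) \<Rightarrow> bool" where
  "P1_feasible L x i z X \<longleftrightarrow> binary (neighbors L i) z \<and> B_tilde L x i z ** X = mat 1"

definition P1_objective ::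
  "(real^('n::finite aug) \<Rightarrow> real) \<Rightarrow> ('n bus \<times> 'n bus) set \<Rightarrow> ('n bus \<Rightarrow> 'n bus \<Rightarrow> real)
    \<Rightarrow> real^'n \<Rightarrow> 'n bus \<Rightarrow> real \<Rightarrow> real \<Rightarrow> real^('n aug)
    \<Rightarrow> 'n switching \<Rightarrow> real^('n aug)^('n aug) \<Rightarrow> real" where
  "P1_objective nrm L x p i g d \<delta> z X = nrm (X *v p_tilde p i g d z - theta_hat L x p i - \<delta>)"

text \<open>The four McCormick inequalities for \<open>Y = \<zeta> X\<close>, entry by entry.\<close>

definition mccormick ::
  "real^'a^'b \<Rightarrow> real^'a^'b \<Rightarrow> real \<Rightarrow> real^'a^'b \<Rightarrow> real^'a^'b \<Rightarrow> bool" where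
  "mccormick Xmin Xmax \<zeta> X Y \<longleftrightarrow> (\<forall>m n.
     Y $ m $ n \<ge> \<zeta> * Xmin $ m $ n \<and>
     Y $ m $ n \<ge> X $ m $ n + \<zeta> * Xmax $ m $ n - Xmax $ m $ n \<and>
     Y $ m $ n \<le> \<zeta> * Xmax $ m $ n \<and>
     Y $ m $ n \<le> X $ m $ n + \<zeta> * Xmin $ m $ n - Xmin $ m $ n)"

definition P2_feasible ::
  "('n::finite bus \<times> 'n bus) set \<Rightarrow> ('n bus \<Rightarrow> 'n bus \<Rightarrow> real) \<Rightarrow> 'n bus
    \<Rightarrow> real^('n aug)^('n aug) \<Rightarrow> real^('n aug)^('n aug)
    \<Rightarrow> 'n switching \<Rightarrow> real^('n aug)^('n aug) \<Rightarrow> ('n bus \<Rightarrow> real^('n aug)^('n aug))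
    \<Rightarrow> real^('n aug)^('n aug) \<Rightarrow> real^('n aug)^('n aug) \<Rightarrow> bool" where
  "P2_feasible L x i Xmin Xmax z X Y Wg Wd \<longleftrightarrow>
     binary (neighbors L i) z \<and>
     B_bar L x ** X + (\<Sum>j \<in> neighbors L i. D_mat x i j ** Y j) = mat 1 \<and>
     (\<forall>j \<in> neighbors L i. mccormick Xmin Xmax (z_line z j) X (Y j)) \<and>
     mccormick Xmin Xmax (z_gen z) X Wg \<and>
     mccormick Xmin Xmax (z_load z) X Wd"

definition P2_objective ::
  "(real^('n::finite aug) \<Rightarrow> real) \<Rightarrow> ('n bus \<times> 'n bus) set \<Rightarrow> ('n bus \<Rightarrow> 'n bus \<Rightarrow> real)
    \<Rightarrow> real^'n \<Rightarrow> 'n bus \<Rightarrow> real \<Rightarrow> real \<Rightarrow> real^('n aug)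
    \<Rightarrow> real^('n aug)^('n aug) \<Rightarrow> real^('n aug)^('n aug) \<Rightarrow> real^('n aug)^('n aug) \<Rightarrow> real" where
  "P2_objective nrm L x p i g d \<delta> X Wg Wd =
     nrm (X *v p_bar p + Wg *v shift i g - Wd *v shift i d - theta_hat L x p i - \<delta>)"

end

theory Submission
  imports Defs
begin

text \<open>
  At a binary point, the four McCormick inequalities leave no freedom: whichever value the switch
  takes, two of them force the auxiliary matrix to be the product of the switch with \<open>X\<close>, and the
  other two confine \<open>X\<close> to the box of the given bounds (\<open>mccormick_binary_iff\<close>). Thus (P2) is (P1)
  with the products \<open>z X\<close> named by new variables and with the box constraint on \<open>X\<close> added. The
  network matrix and the injections are affine in the switches, so naming the products changes
  neither the inverse equation nor the objective (\<open>B_tilde_mult\<close>, \<open>mult_p_tilde\<close>), and the box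
  constraint cuts nothing off because the bounds are valid on the feasible set of (P1).
\<close>

text \<open>
  For \<open>\<zeta> = 0\<close> the first and third inequalities pin \<open>Y\<close> to \<open>0\<close> and the other two become the
  bounds on \<open>X\<close>; for \<open>\<zeta> = 1\<close> the second and fourth pin \<open>Y\<close> to \<open>X\<close>, and the bounds on \<open>X\<close> come
  from the first and third.
\<close>

lemma mccormick_binary_iff:
  assumes "\<zeta> \<in> {0, 1}"
  shows "mccormick Xmin Xmax \<zeta> X Y \<longleftrightarrow>
    Y = \<zeta> *\<^sub>R X \<and> (\<forall>m n. X $ m $ n \<in> {Xmin $ m $ n .. Xmax $ m $ n})"
proof -
  have "u * l \<le> y \<and> a + u * h - h \<le> y \<and> y \<le> u * h \<and> y \<le> a + u * l - l \<longleftrightarrow>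
      y = u * a \<and> a \<in> {l .. h}" if "u \<in> {0, 1}" for u l h a y :: real
    using that by auto
  from this[OF assms] show ?thesis
    by (simp add: mccormick_def vec_eq_iff all_conj_distrib)
qed

lemma matrix_add_rdistrib:
  fixes A B :: "real^'b::finite^'a" and X :: "real^'c^'b"
  shows "(A + B) ** X = A ** X + B ** X"
  by (simp add: matrix_matrix_mult_def vec_eq_iff distrib_right sum.distrib)

lemma sum_matrix_mult:
  fixes A :: "'i \<Rightarrow> real^'b::finite^'a" and X :: "real^'c^'b"
  shows "(\<Sum>j\<in>J. A j) ** X = (\<Sum>j\<in>J. A j ** X)"
  by (induction J rule: infinite_finite_induct)
    (simp_all add: matrix_add_rdistrib)

lemma B_tilde_mult:
  "B_tilde L x i z ** X =
    B_bar L x ** X + (\<Sum>j\<in>neighbors L i. D_mat x i j ** (z_line z j *\<^sub>R X))"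
  by (simp add: B_tilde_def matrix_add_rdistrib sum_matrix_mult matrix_scalar_ac)

lemma mult_p_tilde:
  "X *v p_tilde p i g d z =
    X *v p_bar p + (z_gen z *\<^sub>R X) *v shift i g - (z_load z *\<^sub>R X) *v shift i d"
  by (simp add: p_tilde_def matrix_vector_mult_diff_distrib matrix_vector_right_distrib
      matrix_vector_mult_scaleR scaleR_matrix_vector_assoc)

text \<open>
  (P2) with its auxiliary variables eliminated; both halves of the equivalence can be read off.
\<close>

lemma P2_feasible_iff:
  "P2_feasible L x i Xmin Xmax z X Y Wg Wd \<longleftrightarrow>
    P1_feasible L x i z X \<and> (\<forall>m n. X $ m $ n \<in> {Xmin $ m $ n .. Xmax $ m $ n}) \<and>
    (\<forall>j\<in>neighbors L i. Y j = z_line z j *\<^sub>R X) \<and> Wg = z_gen z *\<^sub>R X \<and> Wd = z_load z *\<^sub>R X"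
  (is "?P2 \<longleftrightarrow> ?P1 \<and> ?box \<and> ?lines \<and> ?gen \<and> ?load")
proof (cases "binary (neighbors L i) z")
  case True
  then have "(\<forall>j\<in>neighbors L i. mccormick Xmin Xmax (z_line z j) X (Y j)) \<and>
      mccormick Xmin Xmax (z_gen z) X Wg \<and> mccormick Xmin Xmax (z_load z) X Wd \<longleftrightarrow>
      ?box \<and> ?lines \<and> ?gen \<and> ?load"
    unfolding binary_def by (auto simp only: mccormick_binary_iff)
  moreover have "B_bar L x ** X + (\<Sum>j\<in>neighbors L i. D_mat x i j ** Y j) = B_tilde L x i z ** X"
    if ?lines
    using that by (simp add: B_tilde_mult)
  ultimately show ?thesis
    using True unfolding P2_feasible_def P1_feasible_def by auto
next
  case False
  then show ?thesis
    by (simp add: P1_feasible_def P2_feasible_def)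
qed

theorem proposition2:
  fixes L :: "('n::finite bus \<times> 'n bus) set"
    and x :: "'n bus \<Rightarrow> 'n bus \<Rightarrow> real"
    and p :: "real^'n"
    and i :: "'n bus"
    and g d :: real
    and \<delta> :: "real^('n aug)"
    and nrm :: "real^('n aug) \<Rightarrow> real"
    and Xmin Xmax :: "real^('n aug)^('n aug)"
  assumes "transmission_network L x"
    and "invertible (B_mat L x)"
    and "\<And>k. i = Some k \<Longrightarrow> p $ k = g - d"
    and "vector_norm nrm"
    and "\<And>m n. Xmin $ m $ n \<le> Xmax $ m $ n"
    and "\<And>z X m n. P1_feasible L x i z X \<Longrightarrow> X $ m $ n \<in> {Xmin $ m $ n .. Xmax $ m $ n}"
  shows "(\<forall>z X. P1_feasible L x i z X \<longleftrightarrow>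
            (\<exists>Y Wg Wd. P2_feasible L x i Xmin Xmax z X Y Wg Wd)) \<and>
         (\<forall>z X Y Wg Wd. P2_feasible L x i Xmin Xmax z X Y Wg Wd \<longrightarrow>
            P1_objective nrm L x p i g d \<delta> z X = P2_objective nrm L x p i g d \<delta> X Wg Wd)"
proof (intro conjI allI impI)
  fix z X
  show "P1_feasible L x i z X \<longleftrightarrow> (\<exists>Y Wg Wd. P2_feasible L x i Xmin Xmax z X Y Wg Wd)"
  proof
    assume "P1_feasible L x i z X"
    with assms(6) have "P2_feasible L x i Xmin Xmax z X
        (\<lambda>j. z_line z j *\<^sub>R X) (z_gen z *\<^sub>R X) (z_load z *\<^sub>R X)"
      unfolding P2_feasible_iff by blast
    then show "\<exists>Y Wg Wd. P2_feasible L x i Xmin Xmax z X Y Wg Wd"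
      by blast
  next
    assume "\<exists>Y Wg Wd. P2_feasible L x i Xmin Xmax z X Y Wg Wd"
    then show "P1_feasible L x i z X"
      unfolding P2_feasible_iff by blast
  qed
next
  fix z X Y Wg Wd
  assume "P2_feasible L x i Xmin Xmax z X Y Wg Wd"
  then show "P1_objective nrm L x p i g d \<delta> z X = P2_objective nrm L x p i g d \<delta> X Wg Wd"
    by (simp add: P2_feasible_iff P1_objective_def P2_objective_def mult_p_tilde)
qed

end
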